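(* Let $k\ge2$ and let $G$ be a $k$-graph with vertex set $\{1,\dots,n\}$ in which every vertex lies in at least one edge, and let $\mathcal L$ be its Laplacian tensor. Then: (a) For any $x\in\mathbb R^n_+$, $\mathcal Lx^k\ge0$, and $$0=\min\Big\{\mathcal Lx^k : x\in\mathbb R^n_+,\ \sum_{i=1}^n x_i^k=1\Big\}.$$ (b) A binary vector $x\in\mathbb R^n$ is a minimal binary H-eigenvector of $\mathcal L$ associated with the H-eigenvalue $\mu_1=0$ if and only if $\mathrm{supp}(x)$ is the vertex set of a component of $G$. (c) A vector $x\in\mathbb R^n$ is an H-eigenvector of $\mathcal L$ associated with the H-eigenvalue $\mu_1=0$ if it is a nonzero linear combination (with real coefficients) of minimal binary H-eigenvectors of $\mathcal L$ associated with the H-eigenvalue $\mu_1=0$.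
   Context: A $k$-graph $G=(V,E)$ consists of a vertex set $V=\{1,\dots,n\}$ and a set $E$ of distinct $k$-element subsets of $V$ (edges). Standing assumption: every vertex lies in at least one edge. The degree $d_i$ of vertex $i$ is the number of edges containing $i$. Two vertices are adjacent if they lie in a common edge; two vertices are connected if they are joined by a finite chain of successively adjacent vertices. The components of $G$ are the $k$-graphs $(V_r,E_r)$ where the $V_r$ are the equivalence classes of the relation of being connected and $E_r$ is the set of edges contained in $V_r$. The adjacency tensor $\mathcal A=(a_{i_1\cdots i_k})$ is the $k$th order $n$-dimensional symmetric tensor with $a_{i_1\cdots i_k}=\frac1{(k-1)!}$ if $\{i_1,\dots,i_k\}\in E$ (in particular the indices are then distinct), and $0$ otherwise. The degree tensor $\mathcal D$ is the $k$th order $n$-dimensional diagonal tensor with $i$th diagonal entry $d_i$. The Laplacian tensor is $\mathcal L=\mathcal D-\mathcal A$. For a real $k$th order $n$-dimensional tensor $\mathcal T=(t_{i_1\cdots i_k})$ and a vector $x$, $\mathcal Tx^k=\sum_{i_1,\dots,i_k=1}^n t_{i_1\cdots i_k}x_{i_1}\cdots x_{i_k}$, $\mathcal Tx^{k-1}$ is the vector with $i$th component $\sum_{i_2,\dots,i_k=1}^n t_{ii_2\cdots i_k}x_{i_2}\cdots x_{i_k}$, and $x^{[k-1]}$ is the vector with components $x_i^{k-1}$. A real number $\mu$ is an H-eigenvalue of $\mathcal T$ with (associated) H-eigenvector $x$ if $x\in\mathbb R^n$, $x\ne0$ and $\mathcal Tx^{k-1}=\mu x^{[k-1]}$. $\mathbb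 R^n_+$ is the set of vectors in $\mathbb R^n$ with nonnegative components; $\mathrm{supp}(x)=\{i: x_i\neq0\}$. A vector $x\in\mathbb R^n$ is binary if each $x_i$ is $0$ or $1$. A binary H-eigenvector $x$ of $\mathcal L$ associated with an H-eigenvalue $\mu$ is a minimal binary H-eigenvector associated with $\mu$ if there is no other binary H-eigenvector $y$ of $\mathcal L$ associated with $\mu$ such that $\mathrm{supp}(y)$ is a proper subset of $\mathrm{supp}(x)$. *)

theory Defs
  imports "HOL-Analysis.Analysis"
begin

text \<open>
  The index set \<open>{1,...,n}\<close>, with arbitrary \<open>n \<ge> 1\<close>, is rendered by a finite type \<open>'n\<close>,
  so that vectors are elements of \<open>real ^ 'n\<close>. Graph notions take an explicit vertex set, since
  the components of a \<open>k\<close>-graph are again \<open>k\<close>-graphs.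
\<close>

definition kgraph :: "nat \<Rightarrow> 'v set \<times> 'v set set \<Rightarrow> bool" where
  "kgraph k G \<longleftrightarrow> finite (fst G) \<and> (\<forall>e\<in>snd G. e \<subseteq> fst G \<and> card e = k)"

definition vdegree :: "'v set \<times> 'v set set \<Rightarrow> 'v \<Rightarrow> nat" where
  "vdegree G i = card {e \<in> snd G. i \<in> e}"

definition vadjacent :: "'v set \<times> 'v set set \<Rightarrow> ('v \<times> 'v) set" where
  "vadjacent G = {(u, v). \<exists>e\<in>snd G. u \<in> e \<and> v \<in> e}"

definition vconnected :: "'v set \<times> 'v set set \<Rightarrow> ('v \<times> 'v) set" where
  "vconnected G = {(u, v). u \<in> fst G \<and> v \<in> fst G \<and> (u, v) \<in> (vadjacent G)\<^sup>*}"

definition kgraph_components ::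
    "'v set \<times> 'v set set \<Rightarrow> ('v set \<times> 'v set set) set" where
  "kgraph_components G = {(C, {e \<in> snd G. e \<subseteq> C}) | C. C \<in> fst G // vconnected G}"


text \<open>
  A tensor of order \<open>k\<close> is a function on index lists \<open>[i\<^sub>1, ..., i\<^sub>k]\<close>; only its values
  on lists of length \<open>k\<close> are ever used.
\<close>

type_synonym 'n tensor = "'n list \<Rightarrow> real"

definition tensor_form :: "nat \<Rightarrow> 'n::finite tensor \<Rightarrow> real ^ 'n \<Rightarrow> real" where
  "tensor_form k T x = (\<Sum>ix | length ix = k. T ix * (\<Prod>i\<leftarrow>ix. x $ i))"

definition tensor_app :: "nat \<Rightarrow> 'n::finite tensor \<Rightarrow> real ^ 'n \<Rightarrow> real ^ 'n" where
  "tensor_app k T x = (\<chi> i. \<Sum>ix | length ix = k - 1. T (i # ix) * (\<Prod>j\<leftarrow>ix. x $ j))"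

definition vec_pow :: "real ^ 'n \<Rightarrow> nat \<Rightarrow> real ^ 'n" where
  "vec_pow x m = (\<chi> i. (x $ i) ^ m)"

definition H_eigenvector :: "nat \<Rightarrow> 'n::finite tensor \<Rightarrow> real \<Rightarrow> real ^ 'n \<Rightarrow> bool" where
  "H_eigenvector k T \<mu> x \<longleftrightarrow> x \<noteq> 0 \<and> tensor_app k T x = \<mu> *\<^sub>R vec_pow x (k - 1)"


text \<open>
  On an index list of length \<open>k\<close>, \<open>set ix \<in> snd G\<close> forces the indices to be distinct, because
  edges have \<open>k\<close> elements.
\<close>

definition adjacency_tensor :: "nat \<Rightarrow> 'n set \<times> 'n set set \<Rightarrow> 'n tensor" where
  "adjacency_tensor k G ix = (if set ix \<in> snd G then 1 / fact (k - 1) else 0)"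

definition degree_tensor :: "nat \<Rightarrow> 'n set \<times> 'n set set \<Rightarrow> 'n tensor" where
  "degree_tensor k G ix = (if ix = replicate k (hd ix) then real (vdegree G (hd ix)) else 0)"

definition laplacian_tensor :: "nat \<Rightarrow> 'n set \<times> 'n set set \<Rightarrow> 'n tensor" where
  "laplacian_tensor k G ix = degree_tensor k G ix - adjacency_tensor k G ix"


definition nonneg_orthant :: "(real ^ 'n) set" where
  "nonneg_orthant = {x. \<forall>i. 0 \<le> x $ i}"

definition supp :: "real ^ 'n \<Rightarrow> 'n set" where
  "supp x = {i. x $ i \<noteq> 0}"

definition binary_vec :: "real ^ 'n \<Rightarrow> bool" where
  "binary_vec x \<longleftrightarrow> (\<forall>i. x $ i = 0 \<or> x $ i = 1)"

definition minimal_binary_H_eigenvector ::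
    "nat \<Rightarrow> 'n::finite tensor \<Rightarrow> real \<Rightarrow> real ^ 'n \<Rightarrow> bool" where
  "minimal_binary_H_eigenvector k T \<mu> x \<longleftrightarrow>
     binary_vec x \<and> H_eigenvector k T \<mu> x \<and>
     \<not> (\<exists>y. binary_vec y \<and> H_eigenvector k T \<mu> y \<and> supp y \<subset> supp x)"

definition is_minimum :: "real set \<Rightarrow> real \<Rightarrow> bool" where
  "is_minimum S m \<longleftrightarrow> m \<in> S \<and> (\<forall>s\<in>S. m \<le> s)"

end

theory Submission
  imports Defs "HOL-Combinatorics.Multiset_Permutations"
begin

text \<open>
  Writing the Laplacian edge by edge gives \<open>\<L>x\<^sup>k = \<Sum>\<^sub>e (\<Sum>\<^sub>i\<^sub>\<in>\<^sub>e x\<^sub>i\<^sup>k - k \<Prod>\<^sub>j\<^sub>\<in>\<^sub>e x\<^sub>j)\<close>, which is nonnegative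
  on the nonnegative orthant by the AM-GM inequality and vanishes at constant vectors.
  The same edge expansion of \<open>\<L>x\<^sup>k\<^sup>-\<^sup>1\<close> shows that it vanishes whenever \<open>x\<close> is constant on every edge, and
  that a binary null vector has a support closed under adjacency. The minimal nonempty
  such supports are the components, and constancy on edges is preserved by linear combinations.
\<close>

section \<open>Expansion of the Laplacian tensor over edges\<close>

lemma finite_lists_of_length: "finite {ix :: 'a::finite list. length ix = m}"
  using finite_lists_length_eq[of "UNIV :: 'a set" m] by simp

lemma prod_list_permutations_of_set:
  fixes f :: "'a \<Rightarrow> 'b::comm_monoid_mult"
  assumes "xs \<in> permutations_of_set A"
  shows "(\<Prod>j\<leftarrow>xs. f j) = (\<Prod>j\<in>A. f j)"
  using permutations_of_setD[OF assms] prod.distinct_set_conv_list[of xs f] by simp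

text \<open>A list of \<open>k\<close> indices that covers a \<open>k\<close>-element set cannot
  repeat an entry, so the tails to be summed over are the orderings of the other
  \<open>k - 1\<close> vertices.\<close>

lemma Cons_index_list_of_edge_iff:
  assumes "card e = k" "k \<ge> 1"
  shows "length ix = k - 1 \<and> set (i # ix) = e \<longleftrightarrow> i \<in> e \<and> ix \<in> permutations_of_set (e - {i})"
proof -
  have fin: "finite e"
    using assms by (metis card.infinite not_one_le_zero)
  show ?thesis
  proof
    assume L: "length ix = k - 1 \<and> set (i # ix) = e"
    then have "card (set (i # ix)) = length (i # ix)"
      using assms by simp
    then have "distinct (i # ix)"
      by (rule card_distinct)
    then show "i \<in> e \<and> ix \<in> permutations_of_set (e - {i})"
      using L by (auto intro!: permutations_of_setI)
  next
    assume R: "i \<in> e \<and> ix \<in> permutations_of_set (e - {i})"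
    then have "set ix = e - {i}" "distinct ix"
      using permutations_of_setD by blast+
    then show "length ix = k - 1 \<and> set (i # ix) = e"
      using R assms fin by (auto simp: distinct_card[symmetric])
  qed
qed

text \<open>All orderings of \<open>e - {i}\<close> contribute the same product. Their number is the
  factorial that cancels the normalisation in \<open>adjacency_tensor\<close>.\<close>

lemma sum_index_lists_of_edge:
  fixes x :: "real ^ 'n::finite"
  assumes "card e = k" "k \<ge> 1"
  shows "(\<Sum>ix | length ix = k - 1 \<and> set (i # ix) = e. \<Prod>j\<leftarrow>ix. x $ j)
    = (if i \<in> e then fact (k - 1) * (\<Prod>j\<in>e - {i}. x $ j) else 0)"
proof -
  have "(\<Sum>ix\<in>permutations_of_set (e - {i}). \<Prod>j\<leftarrow>ix. x $ j)
      = fact (card (e - {i})) * (\<Prod>j\<in>e - {i}. x $ j)"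
    by (simp add: prod_list_permutations_of_set)
  then show ?thesis
    unfolding Cons_index_list_of_edge_iff[OF assms] using assms by auto
qed

lemma tensor_app_adjacency:
  fixes x :: "real ^ 'n::finite"
  assumes "kgraph k G" "k \<ge> 1"
  shows "tensor_app k (adjacency_tensor k G) x $ i = (\<Sum>e | e \<in> snd G \<and> i \<in> e. \<Prod>j\<in>e - {i}. x $ j)"
proof -
  let ?p = "\<lambda>ix. \<Prod>j\<leftarrow>ix. x $ j" and ?L = "{ix :: 'n list. length ix = k - 1}"
  have ck: "card e = k" if "e \<in> snd G" for e
    using assms that by (auto simp: kgraph_def)
  \<comment> \<open>For a given list at most one edge equals \<open>set (i # ix)\<close>, so summing
    over edges reproduces the case distinction of \<open>adjacency_tensor\<close>.\<close>
  have "tensor_app k (adjacency_tensor k G) x $ i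
      = (\<Sum>ix\<in>?L. \<Sum>e\<in>snd G. if set (i # ix) = e then ?p ix / fact (k - 1) else 0)"
    by (auto simp: tensor_app_def adjacency_tensor_def intro!: sum.cong)
  also have "\<dots> = (\<Sum>e\<in>snd G. \<Sum>ix\<in>?L. if set (i # ix) = e then ?p ix / fact (k - 1) else 0)"
    by (rule sum.swap)
  also have "\<dots> = (\<Sum>e\<in>snd G. (\<Sum>ix | length ix = k - 1 \<and> set (i # ix) = e. ?p ix) / fact (k - 1))"
    by (intro sum.cong refl)
      (simp only: sum_divide_distrib sum.inter_filter[OF finite_lists_of_length, symmetric] mem_Collect_eq)
  also have "\<dots> = (\<Sum>e\<in>snd G. if i \<in> e then \<Prod>j\<in>e - {i}. x $ j else 0)"
    using assms(2) by (intro sum.cong refl) (simp only: sum_index_lists_of_edge[OF ck], simp)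
  also have "\<dots> = (\<Sum>e | e \<in> snd G \<and> i \<in> e. \<Prod>j\<in>e - {i}. x $ j)"
    by (simp add: sum.inter_filter)
  finally show ?thesis .
qed

lemma tensor_app_degree:
  fixes x :: "real ^ 'n::finite"
  assumes "k \<ge> 1"
  shows "tensor_app k (degree_tensor k G) x $ i = real (vdegree G i) * (x $ i) ^ (k - 1)"
proof -
  have rep: "i # ix = replicate k i \<longleftrightarrow> ix = replicate (k - 1) i" for ix
    using assms by (cases k) auto
  have "tensor_app k (degree_tensor k G) x $ i
      = (\<Sum>ix | length ix = k - 1. if ix = replicate (k - 1) i
           then real (vdegree G i) * (x $ i) ^ (k - 1) else 0)"
    by (auto simp: tensor_app_def degree_tensor_def rep prod_list_replicate intro!: sum.cong)
  also have "\<dots> = real (vdegree G i) * (x $ i) ^ (k - 1)"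
    by (simp add: sum.delta'[OF finite_lists_of_length] finite_lists_of_length)
  finally show ?thesis .
qed

text \<open>The degree counts the edges at \<open>i\<close>, so the diagonal term hands one copy of
  the power to each of them.\<close>

lemma tensor_app_laplacian:
  fixes x :: "real ^ 'n::finite"
  assumes "kgraph k G" "k \<ge> 1"
  shows "tensor_app k (laplacian_tensor k G) x $ i
    = (\<Sum>e | e \<in> snd G \<and> i \<in> e. (x $ i) ^ (k - 1) - (\<Prod>j\<in>e - {i}. x $ j))"
proof -
  have "tensor_app k (laplacian_tensor k G) x $ i
      = tensor_app k (degree_tensor k G) x $ i - tensor_app k (adjacency_tensor k G) x $ i"
    by (simp add: tensor_app_def laplacian_tensor_def left_diff_distrib sum_subtractf)
  then show ?thesis
    by (simp add: tensor_app_degree[OF assms(2)] tensor_app_adjacency[OF assms] vdegree_def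
        sum_subtractf)
qed

text \<open>Splitting off the first index, which exists because \<open>k \<ge> 1\<close>, lets the
  form inherit the edge expansion.\<close>

lemma tensor_form_eq_inner_tensor_app:
  fixes x :: "real ^ 'n::finite"
  assumes "k \<ge> 1"
  shows "tensor_form k T x = (\<Sum>i\<in>UNIV. x $ i * tensor_app k T x $ i)"
proof -
  let ?L = "{ix :: 'n list. length ix = k - 1}"
  have lists: "{ix :: 'n list. length ix = k} = (\<lambda>(i, ix). i # ix) ` (UNIV \<times> ?L)"
    using assms by (cases k) (auto simp: length_Suc_conv)
  have inj: "inj_on (\<lambda>(i, ix). i # ix) (UNIV \<times> ?L)"
    by (auto simp: inj_on_def)
  have "tensor_form k T x = (\<Sum>(i, ix)\<in>UNIV \<times> ?L. T (i # ix) * (x $ i * (\<Prod>j\<leftarrow>ix. x $ j)))"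
    unfolding tensor_form_def lists by (subst sum.reindex[OF inj]) (simp add: case_prod_unfold)
  also have "\<dots> = (\<Sum>i\<in>UNIV. \<Sum>ix\<in>?L. T (i # ix) * (x $ i * (\<Prod>j\<leftarrow>ix. x $ j)))"
    by (simp add: sum.cartesian_product)
  also have "\<dots> = (\<Sum>i\<in>UNIV. x $ i * tensor_app k T x $ i)"
    by (simp add: tensor_app_def sum_distrib_left mult_ac)
  finally show ?thesis .
qed

lemma tensor_form_laplacian:
  fixes x :: "real ^ 'n::finite"
  assumes "kgraph k G" "k \<ge> 1"
  shows "tensor_form k (laplacian_tensor k G) x
    = (\<Sum>e\<in>snd G. (\<Sum>i\<in>e. (x $ i) ^ k) - real k * (\<Prod>j\<in>e. x $ j))"
proof -
  have ck: "card e = k" if "e \<in> snd G" for e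
    using assms that by (auto simp: kgraph_def)
  \<comment> \<open>The factor \<open>x $ i\<close> raises the power to \<open>k\<close> and
    restores the factor missing from the product over the edge.\<close>
  have step: "x $ i * ((x $ i) ^ (k - 1) - (\<Prod>j\<in>e - {i}. x $ j)) = (x $ i) ^ k - (\<Prod>j\<in>e. x $ j)"
    if "i \<in> e" for i e
    using assms(2) that
    by (simp add: right_diff_distrib power_eq_if[of _ k] prod.remove[of e i "($) x"])
  have "tensor_form k (laplacian_tensor k G) x
      = (\<Sum>i\<in>UNIV. \<Sum>e | e \<in> snd G \<and> i \<in> e. (x $ i) ^ k - (\<Prod>j\<in>e. x $ j))"
    unfolding tensor_form_eq_inner_tensor_app[OF assms(2)] tensor_app_laplacian[OF assms]
      sum_distrib_left
    by (intro sum.cong refl step) simp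
  \<comment> \<open>Incident pairs of a vertex and an edge are now grouped by edge; each edge has
    \<open>k\<close> vertices, hence the coefficient \<open>k\<close>.\<close>
  also have "\<dots> = (\<Sum>e\<in>snd G. \<Sum>i | i \<in> UNIV \<and> i \<in> e. (x $ i) ^ k - (\<Prod>j\<in>e. x $ j))"
    by (rule sum.swap_restrict) auto
  also have "\<dots> = (\<Sum>e\<in>snd G. (\<Sum>i\<in>e. (x $ i) ^ k) - real k * (\<Prod>j\<in>e. x $ j))"
    by (simp add: sum_subtractf ck)
  finally show ?thesis .
qed

section \<open>Nonnegativity on the orthant\<close>

text \<open>This is AM-GM for the numbers \<open>f i ^ card S\<close>: by nonnegativity of
  \<open>f\<close>, their geometric mean is the plain product.\<close>

lemma card_mult_prod_le_sum_power:
  fixes f :: "'a \<Rightarrow> real"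
  assumes "finite S" and nonneg: "\<And>i. i \<in> S \<Longrightarrow> f i \<ge> 0"
  shows "card S * (\<Prod>i\<in>S. f i) \<le> (\<Sum>i\<in>S. f i ^ card S)"
proof (cases "S = {}")
  case False
  then have pos: "card S > 0"
    using assms by (simp add: card_gt_0_iff)
  have "(\<Prod>i\<in>S. f i ^ card S) powr (1 / card S) = (\<Prod>i\<in>S. f i)"
    using pos nonneg
    by (simp add: prod_power_distrib[symmetric] prod_nonneg root_powr_inverse[symmetric] real_root_power_cancel)
  then have "(\<Prod>i\<in>S. f i) \<le> (\<Sum>i\<in>S. f i ^ card S / card S)"
    using arith_geom_mean[of S "\<lambda>i. f i ^ card S"] assms False by simp
  then show ?thesis
    using pos by (simp add: sum_divide_distrib[symmetric] field_simps)
qed simp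

lemma tensor_form_laplacian_nonneg:
  fixes x :: "real ^ 'n::finite"
  assumes "kgraph k G" "k \<ge> 1" "x \<in> nonneg_orthant"
  shows "tensor_form k (laplacian_tensor k G) x \<ge> 0"
  unfolding tensor_form_laplacian[OF assms(1,2)]
proof (rule sum_nonneg)
  fix e assume "e \<in> snd G"
  then have "card e = k"
    using assms by (auto simp: kgraph_def)
  then show "0 \<le> (\<Sum>i\<in>e. (x $ i) ^ k) - real k * (\<Prod>j\<in>e. x $ j)"
    using card_mult_prod_le_sum_power[of e "($) x"] assms(3) by (auto simp: nonneg_orthant_def)
qed

section \<open>Null vectors and constancy on edges\<close>

text \<open>Adjacent means sharing an edge, so \<open>x\<close> is constant on each edge. The
  product over the other vertices is then the same power of \<open>x $ i\<close>, and every edge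
  term cancels.\<close>

lemma tensor_app_laplacian_eq_0:
  fixes x :: "real ^ 'n::finite"
  assumes "kgraph k G" "k \<ge> 1" and const: "\<forall>(u, v)\<in>vadjacent G. x $ u = x $ v"
  shows "tensor_app k (laplacian_tensor k G) x = 0"
proof -
  have "(\<Prod>j\<in>e - {i}. x $ j) = (x $ i) ^ (k - 1)" if "e \<in> snd G" "i \<in> e" for e i
  proof -
    have "(\<Prod>j\<in>e - {i}. x $ j) = (\<Prod>j\<in>e - {i}. x $ i)"
      using const that by (intro prod.cong refl) (auto simp: vadjacent_def)
    also have "\<dots> = (x $ i) ^ (k - 1)"
      using assms that by (auto simp: kgraph_def)
    finally show ?thesis .
  qed
  then show ?thesis
    by (simp add: vec_eq_iff tensor_app_laplacian[OF assms(1,2)])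
qed

text \<open>At a vertex of value 1 the edge terms are nonnegative and sum to zero, so each vanishes;
  a neighbour of value 0 would make one of them equal to 1.\<close>

lemma binary_laplacian_null_imp_constant_on_edges:
  fixes x :: "real ^ 'n::finite"
  assumes "kgraph k G" "k \<ge> 1" and bin: "binary_vec x"
    and null: "tensor_app k (laplacian_tensor k G) x = 0"
    and adj: "(u, v) \<in> vadjacent G" and one: "x $ u = 1"
  shows "x $ v = 1"
proof (rule ccontr)
  assume "x $ v \<noteq> 1"
  with bin have v: "x $ v = 0"
    by (auto simp: binary_vec_def)
  obtain e where e: "e \<in> snd G" "u \<in> e" "v \<in> e"
    using adj by (auto simp: vadjacent_def)
  have "(\<Sum>e | e \<in> snd G \<and> u \<in> e. 1 - (\<Prod>j\<in>e - {u}. x $ j)) = 0"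
    using null tensor_app_laplacian[OF assms(1,2), of x u] one by simp
  moreover have "0 \<le> 1 - (\<Prod>j\<in>e - {u}. x $ j)" for e
    using bin by (auto simp: binary_vec_def intro!: prod_le_1) (metis order.refl zero_le_one)+
  ultimately have "(\<Prod>j\<in>e - {u}. x $ j) = 1"
    using e by (subst (asm) sum_nonneg_eq_0_iff) auto
  \<comment> \<open>The values at \<open>u\<close> and \<open>v\<close> differ, so \<open>v\<close>
    survives in \<open>e - {u}\<close> and supplies a zero factor.\<close>
  moreover have "(\<Prod>j\<in>e - {u}. x $ j) = 0"
    using e v one by (intro prod_zero) auto
  ultimately show False
    by simp
qed

section \<open>Binary null vectors and components\<close>

lemma sym_vadjacent: "sym (vadjacent G)"
  by (auto simp: sym_def vadjacent_def)

text \<open>A null vector propagates the value 1 to neighbours. Conversely, as adjacency is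
  symmetric, a closed support makes a binary vector constant on edges.\<close>

lemma binary_H_eigenvector_laplacian_iff:
  fixes x :: "real ^ 'n::finite"
  assumes "kgraph k G" "k \<ge> 1" "binary_vec x"
  shows "H_eigenvector k (laplacian_tensor k G) 0 x \<longleftrightarrow>
    supp x \<noteq> {} \<and> vadjacent G `` supp x \<subseteq> supp x"
proof -
  have nz: "x \<noteq> 0 \<longleftrightarrow> supp x \<noteq> {}"
    by (auto simp: supp_def vec_eq_iff)
  have one: "x $ i = 1 \<longleftrightarrow> i \<in> supp x" for i
    using assms(3) by (auto simp: supp_def binary_vec_def)
  have zero: "x $ i = 0 \<longleftrightarrow> i \<notin> supp x" for i
    by (auto simp: supp_def)
  have "tensor_app k (laplacian_tensor k G) x = 0 \<longleftrightarrow> vadjacent G `` supp x \<subseteq> supp x"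
  proof
    assume "tensor_app k (laplacian_tensor k G) x = 0"
    then show "vadjacent G `` supp x \<subseteq> supp x"
      using binary_laplacian_null_imp_constant_on_edges[OF assms] by (auto simp: one)
  next
    assume closed: "vadjacent G `` supp x \<subseteq> supp x"
    have "x $ u = x $ v" if "(u, v) \<in> vadjacent G" for u v
    proof -
      have "u \<in> supp x \<longleftrightarrow> v \<in> supp x"
        using closed that symD[OF sym_vadjacent that] by blast
      then show ?thesis
        by (metis one zero)
    qed
    then show "tensor_app k (laplacian_tensor k G) x = 0"
      by (intro tensor_app_laplacian_eq_0 assms) auto
  qed
  then show ?thesis
    by (auto simp: H_eigenvector_def nz)
qed

text \<open>Minimality among nonempty sets closed under a symmetric relation singles out the sets
  reachable from one point.\<close>

lemma minimal_binary_H_eigenvector_laplacian_iff: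
  fixes x :: "real ^ 'n::finite"
  assumes "kgraph k G" "k \<ge> 1" "binary_vec x"
  shows "minimal_binary_H_eigenvector k (laplacian_tensor k G) 0 x \<longleftrightarrow>
    (\<exists>u. supp x = (vadjacent G)\<^sup>* `` {u})"
proof
  let ?ind = "\<lambda>S. (\<chi> i. if i \<in> S then 1 else 0) :: real ^ 'n"
  have ind: "binary_vec (?ind S)" "supp (?ind S) = S" for S
    by (auto simp: binary_vec_def supp_def)
  note iff = binary_H_eigenvector_laplacian_iff[OF assms(1,2)]
  assume min: "minimal_binary_H_eigenvector k (laplacian_tensor k G) 0 x"
  then have closed: "supp x \<noteq> {}" "vadjacent G `` supp x \<subseteq> supp x"
    using iff by (auto simp: minimal_binary_H_eigenvector_def)
  then obtain u where u: "u \<in> supp x"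
    by blast
  let ?C = "(vadjacent G)\<^sup>* `` {u}"
  have "?C \<subseteq> supp x"
    using Image_closed_trancl[OF closed(2)] u by blast
  \<comment> \<open>The indicator vector of the reachable set is a competitor, so minimality of
    \<open>x\<close> excludes a proper inclusion.\<close>
  moreover have "H_eigenvector k (laplacian_tensor k G) 0 (?ind ?C)"
    unfolding iff[OF ind(1)] ind(2) by (auto intro: rtrancl.rtrancl_into_rtrancl)
  then have "\<not> ?C \<subset> supp x"
    using min ind unfolding minimal_binary_H_eigenvector_def by metis
  ultimately show "\<exists>u. supp x = (vadjacent G)\<^sup>* `` {u}"
    by blast
next
  note iff = binary_H_eigenvector_laplacian_iff[OF assms(1,2)]
  assume "\<exists>u. supp x = (vadjacent G)\<^sup>* `` {u}"
  then obtain u where u: "supp x = (vadjacent G)\<^sup>* `` {u}"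
    by blast
  have "H_eigenvector k (laplacian_tensor k G) 0 x"
    unfolding iff[OF assms(3)] u by (auto intro: rtrancl.rtrancl_into_rtrancl)
  moreover have False
    if "binary_vec y" "H_eigenvector k (laplacian_tensor k G) 0 y" "supp y \<subset> supp x" for y
  proof -
    have closed: "supp y \<noteq> {}" "vadjacent G `` supp y \<subseteq> supp y"
      using iff that by auto
    then obtain w where w: "w \<in> supp y"
      by blast
    then have "(u, w) \<in> (vadjacent G)\<^sup>*"
      using that u by auto
    \<comment> \<open>By symmetry \<open>w\<close> leads back to \<open>u\<close>, so a closed set
      containing \<open>w\<close> already contains all of \<open>supp x\<close>.\<close>
    then have "(w, u) \<in> (vadjacent G)\<^sup>*"
      using sym_vadjacent by (meson sym_rtrancl symD)
    then have "supp x \<subseteq> (vadjacent G)\<^sup>* `` supp y"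
      using u w by (auto intro: rtrancl_trans)
    then show False
      using that(3) Image_closed_trancl[OF closed(2)] by auto
  qed
  ultimately show "minimal_binary_H_eigenvector k (laplacian_tensor k G) 0 x"
    using assms(3) by (auto simp: minimal_binary_H_eigenvector_def)
qed

lemma ex_kgraph_component_iff:
  assumes "fst G = UNIV"
  shows "(\<exists>C\<in>kgraph_components G. S = fst C) \<longleftrightarrow> (\<exists>u. S = (vadjacent G)\<^sup>* `` {u})"
proof -
  have "vconnected G = (vadjacent G)\<^sup>*"
    using assms by (auto simp: vconnected_def)
  then show ?thesis
    using assms by (auto simp: kgraph_components_def quotient_def)
qed

section \<open>Linear combinations and the attained minimum\<close>

text \<open>For \<open>k > 2\<close> the null equation is not linear in \<open>x\<close>. The linear
  condition \<open>?W\<close> of constancy on edges replaces it: it holds for the generators, passes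
  to their span and implies the equation.\<close>

lemma tensor_app_laplacian_span_minimal_eq_0:
  fixes x :: "real ^ 'n::finite"
  assumes "kgraph k G" "k \<ge> 1"
    and x: "x \<in> span {y. minimal_binary_H_eigenvector k (laplacian_tensor k G) 0 y}"
  shows "tensor_app k (laplacian_tensor k G) x = 0"
proof -
  let ?W = "{y :: real ^ 'n. \<forall>(u, v)\<in>vadjacent G. y $ u = y $ v}"
  have "y \<in> ?W" if "minimal_binary_H_eigenvector k (laplacian_tensor k G) 0 y" for y
  proof -
    have bin: "binary_vec y" and null: "tensor_app k (laplacian_tensor k G) y = 0"
      using that by (auto simp: minimal_binary_H_eigenvector_def H_eigenvector_def)
    note one = binary_laplacian_null_imp_constant_on_edges[OF assms(1,2) bin null]
    have "y $ u = y $ v" if "(u, v) \<in> vadjacent G" for u v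
      using one[OF that] one[OF symD[OF sym_vadjacent that]] bin unfolding binary_vec_def by metis
    then show ?thesis
      by auto
  qed
  then have "{y. minimal_binary_H_eigenvector k (laplacian_tensor k G) 0 y} \<subseteq> ?W"
    by (intro subsetI) (simp only: mem_Collect_eq)
  moreover have "subspace ?W"
    by (auto simp: subspace_def split_beta)
  ultimately have "x \<in> ?W"
    by (rule subsetD[OF span_minimal x])
  then show ?thesis
    by (intro tensor_app_laplacian_eq_0 assms) auto
qed

theorem theorem8:
  fixes k :: nat and E :: "'n::finite set set" and G :: "'n set \<times> 'n set set"
  assumes "k \<ge> 2"
    and "G = (UNIV, E)"
    and "kgraph k G"
    and "\<forall>i. \<exists>e\<in>E. i \<in> e"
  shows
    "((\<forall>x :: real ^ 'n. x \<in> nonneg_orthant \<longrightarrow> tensor_form k (laplacian_tensor k G) x \<ge> 0) \<and>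
      is_minimum {tensor_form k (laplacian_tensor k G) x | x :: real ^ 'n.
                    x \<in> nonneg_orthant \<and> (\<Sum>i\<in>UNIV. (x $ i) ^ k) = 1} 0) \<and>
     (\<forall>x :: real ^ 'n. binary_vec x \<longrightarrow>
        (minimal_binary_H_eigenvector k (laplacian_tensor k G) 0 x \<longleftrightarrow>
         (\<exists>C\<in>kgraph_components G. supp x = fst C))) \<and>
     (\<forall>x :: real ^ 'n.
        x \<in> span {y. minimal_binary_H_eigenvector k (laplacian_tensor k G) 0 y} \<and> x \<noteq> 0 \<longrightarrow>
        H_eigenvector k (laplacian_tensor k G) 0 x)"
proof -
  note kG = assms(3)
  have k1: "k \<ge> 1"
    using assms(1) by simp
  \<comment> \<open>The constant is chosen so that \<open>CARD('n)\<close> equal \<open>k\<close>-th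
    powers add up to 1.\<close>
  let ?c = "root k (1 / CARD('n))"
  let ?x0 = "(\<chi> i. ?c) :: real ^ 'n"
  have x0: "?x0 \<in> nonneg_orthant" "(\<Sum>i\<in>UNIV. (?x0 $ i) ^ k) = 1"
    using k1 by (auto simp: nonneg_orthant_def)
  have "tensor_app k (laplacian_tensor k G) ?x0 = 0"
    by (rule tensor_app_laplacian_eq_0[OF kG k1]) auto
  then have "tensor_form k (laplacian_tensor k G) ?x0 = 0"
    by (simp add: tensor_form_eq_inner_tensor_app[OF k1])
  then have "0 \<in> {tensor_form k (laplacian_tensor k G) x | x :: real ^ 'n.
      x \<in> nonneg_orthant \<and> (\<Sum>i\<in>UNIV. (x $ i) ^ k) = 1}"
    using x0 by (intro CollectI exI[of _ ?x0]) (simp only: simp_thms)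
  then have "is_minimum {tensor_form k (laplacian_tensor k G) x | x :: real ^ 'n.
      x \<in> nonneg_orthant \<and> (\<Sum>i\<in>UNIV. (x $ i) ^ k) = 1} 0"
    using tensor_form_laplacian_nonneg[OF kG k1] by (auto simp: is_minimum_def)
  moreover have "fst G = UNIV"
    using assms(2) by simp
  moreover have "H_eigenvector k (laplacian_tensor k G) 0 x"
    if "x \<in> span {y. minimal_binary_H_eigenvector k (laplacian_tensor k G) 0 y}" "x \<noteq> 0"
    for x :: "real ^ 'n"
    using that tensor_app_laplacian_span_minimal_eq_0[OF kG k1] by (simp add: H_eigenvector_def)
  ultimately show ?thesis
    using tensor_form_laplacian_nonneg[OF kG k1] minimal_binary_H_eigenvector_laplacian_iff[OF kG k1]
    by (simp add: ex_kgraph_component_iff)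
qed

end
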